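(* Assume the model and conditions (A.1)--(A.5) listed in the context, and that the smallest eigenvalue of $E[AA^\top]$ is bounded away from zero. Let $T=E[f(q_0,X^\top\beta^0)]\neq0$, $\tau(X)=h(q_0,X^\top\beta^0)(1-h(q_0,X^\top\beta^0))$, $r(X)=\pi(X)^{-1}$ and $e(X)=\tau(X)^{-1}A$. Define $\sigma^2=T^{-2}V$ and $\sigma_b^2=T^{-2}V_b$, where $$V=\frac14E\left[\frac{\eta^{*\top}\delta AA^\top\eta^*}{\tau(X)}\right]+\mathrm{Var}\left(h(q_0,X^\top\beta^0)\right),\qquad V_b=E\left[\delta\,\tau(X)\,r(X)^2\right]+\mathrm{Var}\left(h(q_0,X^\top\beta^0)\right).$$ Then $\sigma^2\le\sigma_b^2$, and the inequality is strict if $r(X)$ does not belong to the linear span of the components of $e(X)$ in the Hilbert space of functions $g$ with $E[\delta\tau(X)g(X)^2]<\infty$ with inner product $\langle g_1,g_2\rangle_{\#}=E[\delta\tau(X)g_1(X)g_2(X)]$.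
   Context: Model. $Y$ is a real response, $X$ a $p$-dimensional covariate vector, and $\delta\in\{0,1\}$ the indicator that $Y$ is observed. Missing at random: $P(\delta=1\mid Y,X)=P(\delta=1\mid X)=:\pi(X)$. The conditional density of $Y$ given $X=x$ is $f(y,x^\top\beta^0)$, where $f$ is a known function and $\beta^0\in\mathbb R^p$; $h(y,u)=\int_{-\infty}^y f(t,u)\,dt$, so $h(y,x^\top\beta^0)=P(Y\le y\mid X=x)$. There is no intercept and the covariates are centered. A quantile level in $(0,1)$ (a constant, not to be confused with the function $\tau(X)$ of the claim) is fixed and $q_0$ is the corresponding quantile of $Y$, i.e. the infimum of those $y$ at which the distribution function of $Y$ is at least that level. Notation. $\dot h_u(q,u)=\partial h(q,u)/\partial u$. $A=(\dot h_u(q_0,X^\top\beta^0)X^\top,1)^\top\in\mathbb R^{p+1}$ and $$\eta^*=\arg\min_{\eta\in\mathbb R^{p+1}}\ \frac14E\left[\frac{\eta^\top\delta AA^\top\eta}{h(q_0,X^\top\beta^0)(1-h(q_0,X^\top\beta^0))}\right]-E[A^\top]\eta.$$ Elements of the Hilbert space in the claim are identified when their difference has norm zero. Here $\sigma^2$ is the asymptotic variance of the paper's proposed estimator of $q_0$ and $\sigma_b^2$ is the asymptotic variance of the augmented inverse probability weighted estimator. Conditions. (A.1) (i) The parameter space $\mathcal Q\subset\mathbb R$ for $q$ is compact and $q_0$ is in its interior. (ii) $Y$ is a real-valued continuous random variable with strictly increasing cumulative distribution function. (A.2) $\inf_x\pi(x)>0$. (A.3) (i) $0<\inf_x|h(q_0,x^\top\beta^0)|\le\sup_x|h(q_0,x^\top\beta^0)|<1$.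 (ii) $\sup_{(q,u)}|\dot h_u(q,u)|<\infty$. (iii) There are positive constants $L_1,L_2$ with $|\dot h_u(q_1,u_1)-\dot h_u(q_2,u_2)|\le L_1(|q_1-q_2|+|u_1-u_2|)$ and $|f(q_1,u_1)-f(q_2,u_2)|\le L_2(|q_1-q_2|+|u_1-u_2|)$. (In (A.2) and (A.3)(i), $x$ ranges over the support of $X$.) (A.4) (i) $\max_{1\le j\le p}|X_j|\le K$ almost surely for a positive constant $K$. (ii) The smallest and largest eigenvalues of $E[XX^\top]$ lie in $[c_{\min},c_{\max}]$ for constants $0<c_{\min}\le c_{\max}<\infty$. (A.5) Let $D=(X,Y,\delta)$, $\tilde y=(y,\delta)$ and $\rho_\beta(x,\tilde y)=-\delta\log f(y,x^\top\beta)$, assumed convex in $\beta$. (i) There are positive constants $c,c_m$ such that $E[\rho_\beta(D)-\rho_{\beta^0}(D)]\ge c_m\|\beta-\beta^0\|_2^2$ for all $\beta$ with $\|\beta-\beta^0\|_1\le c$. (ii) For all $\beta,\tilde\beta$, $|\rho_\beta(x,\tilde y)-\rho_{\tilde\beta}(x,\tilde y)|\le L_\rho|x^\top\beta-x^\top\tilde\beta|$, where $L_\rho$ is a positive constant not depending on $\tilde y$. *)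

theory Defs
  imports "HOL-Probability.Probability"
begin

definition eigenvalues :: "real^'n^'n \<Rightarrow> real set" where
  "eigenvalues B = {l. \<exists>v. v \<noteq> 0 \<and> B *v v = l *\<^sub>R v}"

text \<open>Only applied to second-moment matrices, which are symmetric, so that the set of real
  eigenvalues is finite and nonempty.\<close>

definition min_eigenvalue :: "real^'n^'n \<Rightarrow> real" where
  "min_eigenvalue B = Min (eigenvalues B)"

definition max_eigenvalue :: "real^'n^'n \<Rightarrow> real" where
  "max_eigenvalue B = Max (eigenvalues B)"

definition outer :: "real^'n \<Rightarrow> real^'n^'n" where
  "outer v = (\<chi> i j. v $ i * v $ j)"

definition support_of :: "'b::topological_space measure \<Rightarrow> 'b set" where
  "support_of N = {x. \<forall>U. open U \<and> x \<in> U \<longrightarrow> emeasure N U > 0}"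

definition quantile :: "real measure \<Rightarrow> real \<Rightarrow> real" where
  "quantile N \<alpha> = Inf {y. \<alpha> \<le> cdf N y}"

definition h :: "(real \<Rightarrow> real \<Rightarrow> real) \<Rightarrow> real \<Rightarrow> real \<Rightarrow> real" where
  "h f y u = (LINT t:{..y}|lborel. f t u)"

definition h_dot :: "(real \<Rightarrow> real \<Rightarrow> real) \<Rightarrow> real \<Rightarrow> real \<Rightarrow> real" where
  "h_dot f q u = deriv (\<lambda>v. h f q v) u"

text \<open>The vector \<open>A\<close> at \<open>X = x\<close>; its \<open>p + 1\<close> coordinates are indexed by
  \<^typ>\<open>'p option\<close>, with \<^const>\<open>None\<close> for the last one.\<close>

definition A_vec ::
  "(real \<Rightarrow> real \<Rightarrow> real) \<Rightarrow> real \<Rightarrow> real^'p \<Rightarrow> real^'p \<Rightarrow> real^('p option)" where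
  "A_vec f q \<beta> x = (\<chi> i. case i of Some j \<Rightarrow> h_dot f q (x \<bullet> \<beta>) * x $ j | None \<Rightarrow> 1)"

text \<open>In the conditional density assumption, the joint law of \<open>(X, Y)\<close> has density
  \<open>f (y, x \<bullet> \<beta>)\<close> with respect to the product of the law of \<open>X\<close> and Lebesgue measure.
  Integrability of \<open>f (\<cdot>, u)\<close> on lower half-lines is what makes \<^const>\<open>h\<close> meaningful
  at every \<open>u\<close>.\<close>

locale mar_model = prob_space M
  for M :: "'a measure" +
  fixes X :: "'a \<Rightarrow> real^'p" and Y \<delta> :: "'a \<Rightarrow> real"
    and \<pi> :: "real^'p \<Rightarrow> real" and f :: "real \<Rightarrow> real \<Rightarrow> real" and \<beta>0 :: "real^'p"
  assumes X_rv: "X \<in> borel_measurable M"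
    and Y_rv: "Y \<in> borel_measurable M"
    and delta_rv: "\<delta> \<in> borel_measurable M"
    and delta_01: "\<And>\<omega>. \<omega> \<in> space M \<Longrightarrow> \<delta> \<omega> \<in> {0, 1}"
    and pi_measurable: "\<pi> \<in> borel_measurable borel"
    and mar_YX: "AE \<omega> in M.
      real_cond_exp M (vimage_algebra (space M) (\<lambda>\<omega>. (Y \<omega>, X \<omega>)) borel)
        (indicator {\<omega> \<in> space M. \<delta> \<omega> = 1}) \<omega> =
      real_cond_exp M (vimage_algebra (space M) X borel)
        (indicator {\<omega> \<in> space M. \<delta> \<omega> = 1}) \<omega>"
    and mar_X: "AE \<omega> in M.
      real_cond_exp M (vimage_algebra (space M) X borel)
        (indicator {\<omega> \<in> space M. \<delta> \<omega> = 1}) \<omega> = \<pi> (X \<omega>)"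
    and f_measurable: "(\<lambda>(y, u). f y u) \<in> borel_measurable borel"
    and f_nonneg: "\<And>y u. f y u \<ge> 0"
    and f_integrable: "\<And>y u. set_integrable lborel {..y} (\<lambda>t. f t u)"
    and cond_density: "distr M (borel \<Otimes>\<^sub>M borel) (\<lambda>\<omega>. (X \<omega>, Y \<omega>)) =
      density (distr M borel X \<Otimes>\<^sub>M lborel) (\<lambda>(x, y). ennreal (f y (x \<bullet> \<beta>0)))"
    and X_centered: "(LINT \<omega>|M. X \<omega>) = 0"

definition cond_A1 :: "'a measure \<Rightarrow> ('a \<Rightarrow> real) \<Rightarrow> real set \<Rightarrow> real \<Rightarrow> bool" where
  "cond_A1 M Y Q q0 \<longleftrightarrow>
     compact Q \<and> q0 \<in> interior Q \<and>
     continuous_on UNIV (cdf (distr M borel Y)) \<and> strict_mono (cdf (distr M borel Y))"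

text \<open>Infima and suprema of real-valued functions are taken in \<^typ>\<open>ereal\<close>, where they always
  exist.\<close>

definition cond_A2 :: "'a measure \<Rightarrow> ('a \<Rightarrow> real^'p) \<Rightarrow> (real^'p \<Rightarrow> real) \<Rightarrow> bool" where
  "cond_A2 M X \<pi> \<longleftrightarrow> 0 < (INF x \<in> support_of (distr M borel X). ereal (\<pi> x))"

definition cond_A3 ::
  "'a measure \<Rightarrow> ('a \<Rightarrow> real^'p) \<Rightarrow> (real \<Rightarrow> real \<Rightarrow> real) \<Rightarrow> real^'p \<Rightarrow> real set \<Rightarrow> real \<Rightarrow> bool" where
  "cond_A3 M X f \<beta>0 Q q0 \<longleftrightarrow>
     0 < (INF x \<in> support_of (distr M borel X). ereal \<bar>h f q0 (x \<bullet> \<beta>0)\<bar>) \<and>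
     (SUP x \<in> support_of (distr M borel X). ereal \<bar>h f q0 (x \<bullet> \<beta>0)\<bar>) < 1 \<and>
     (\<forall>q\<in>Q. \<forall>u. (\<lambda>v. h f q v) differentiable (at u)) \<and>
     (SUP (q, u) \<in> Q \<times> UNIV. ereal \<bar>h_dot f q u\<bar>) < \<infinity> \<and>
     (\<exists>L1 > 0. \<forall>q1\<in>Q. \<forall>q2\<in>Q. \<forall>u1 u2.
        \<bar>h_dot f q1 u1 - h_dot f q2 u2\<bar> \<le> L1 * (\<bar>q1 - q2\<bar> + \<bar>u1 - u2\<bar>)) \<and>
     (\<exists>L2 > 0. \<forall>q1\<in>Q. \<forall>q2\<in>Q. \<forall>u1 u2.
        \<bar>f q1 u1 - f q2 u2\<bar> \<le> L2 * (\<bar>q1 - q2\<bar> + \<bar>u1 - u2\<bar>))"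

definition cond_A4 :: "'a measure \<Rightarrow> ('a \<Rightarrow> real^'p) \<Rightarrow> bool" where
  "cond_A4 M X \<longleftrightarrow>
     (\<exists>K > 0. AE \<omega> in M. \<forall>j. \<bar>X \<omega> $ j\<bar> \<le> K) \<and>
     (\<exists>c_min c_max. 0 < c_min \<and> c_min \<le> c_max \<and>
        min_eigenvalue (LINT \<omega>|M. outer (X \<omega>)) \<in> {c_min..c_max} \<and>
        max_eigenvalue (LINT \<omega>|M. outer (X \<omega>)) \<in> {c_min..c_max})"

text \<open>The convention \<^prop>\<open>ln 0 = (0::real)\<close> only makes the condition below less restrictive:
  with \<open>-\<infinity>\<close> in place of \<open>0\<close>, the Lipschitz bound could only hold if \<open>f (y, \<cdot>)\<close>
  were everywhere positive or identically zero, and in the latter case \<open>\<rho>\<close> is constantly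
  zero here.\<close>

definition \<rho> :: "(real \<Rightarrow> real \<Rightarrow> real) \<Rightarrow> real^'p \<Rightarrow> real^'p \<Rightarrow> real \<times> real \<Rightarrow> real" where
  "\<rho> f \<beta> x = (\<lambda>(y, d). - d * ln (f y (x \<bullet> \<beta>)))"

definition cond_A5 ::
  "'a measure \<Rightarrow> ('a \<Rightarrow> real^'p) \<Rightarrow> ('a \<Rightarrow> real) \<Rightarrow> ('a \<Rightarrow> real) \<Rightarrow> (real \<Rightarrow> real \<Rightarrow> real) \<Rightarrow> real^'p \<Rightarrow> bool"
where
  "cond_A5 M X Y \<delta> f \<beta>0 \<longleftrightarrow>
     (\<forall>(x :: real^'p) y. \<forall>d\<in>{0, 1}. convex_on UNIV (\<lambda>\<beta>. \<rho> f \<beta> x (y, d))) \<and>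
     (\<exists>c > 0. \<exists>c_m > 0. \<forall>\<beta>. (\<Sum>j\<in>UNIV. \<bar>(\<beta> - \<beta>0) $ j\<bar>) \<le> c \<longrightarrow>
        (LINT \<omega>|M. \<rho> f \<beta> (X \<omega>) (Y \<omega>, \<delta> \<omega>) - \<rho> f \<beta>0 (X \<omega>) (Y \<omega>, \<delta> \<omega>))
          \<ge> c_m * (norm (\<beta> - \<beta>0))\<^sup>2) \<and>
     (\<exists>L > 0. \<forall>(\<beta> :: real^'p) \<beta>' x y. \<forall>d\<in>{0, 1}.
        \<bar>\<rho> f \<beta> x (y, d) - \<rho> f \<beta>' x (y, d)\<bar> \<le> L * \<bar>x \<bullet> \<beta> - x \<bullet> \<beta>'\<bar>)"

definition hilbert_carrier ::
  "'a measure \<Rightarrow> ('a \<Rightarrow> real^'p) \<Rightarrow> ('a \<Rightarrow> real) \<Rightarrow> (real^'p \<Rightarrow> real) \<Rightarrow> (real^'p \<Rightarrow> real) set" where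
  "hilbert_carrier M X \<delta> \<tau> = {g \<in> borel_measurable borel.
     integrable M (\<lambda>\<omega>. \<delta> \<omega> * \<tau> (X \<omega>) * (g (X \<omega>))\<^sup>2)}"

definition hilbert_inner ::
  "'a measure \<Rightarrow> ('a \<Rightarrow> real^'p) \<Rightarrow> ('a \<Rightarrow> real) \<Rightarrow> (real^'p \<Rightarrow> real)
    \<Rightarrow> (real^'p \<Rightarrow> real) \<Rightarrow> (real^'p \<Rightarrow> real) \<Rightarrow> real" where
  "hilbert_inner M X \<delta> \<tau> g1 g2 = (LINT \<omega>|M. \<delta> \<omega> * \<tau> (X \<omega>) * g1 (X \<omega>) * g2 (X \<omega>))"

text \<open>Functions, rather than equivalence classes, represent the elements of the Hilbert space, so
  belonging to the span means being at distance zero from a linear combination.\<close>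

definition hilbert_span ::
  "'a measure \<Rightarrow> ('a \<Rightarrow> real^'p) \<Rightarrow> ('a \<Rightarrow> real) \<Rightarrow> (real^'p \<Rightarrow> real)
    \<Rightarrow> (real^'p \<Rightarrow> real^'n) \<Rightarrow> (real^'p \<Rightarrow> real) set" where
  "hilbert_span M X \<delta> \<tau> e = {g \<in> hilbert_carrier M X \<delta> \<tau>.
     \<exists>a :: 'n \<Rightarrow> real. let d = (\<lambda>x. g x - (\<Sum>i\<in>UNIV. a i * e x $ i)) in
       sqrt (hilbert_inner M X \<delta> \<tau> d d) = 0}"

definition eta_star ::
  "'a measure \<Rightarrow> ('a \<Rightarrow> real^'p) \<Rightarrow> ('a \<Rightarrow> real) \<Rightarrow> (real \<Rightarrow> real \<Rightarrow> real) \<Rightarrow> real^'p \<Rightarrow> real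
    \<Rightarrow> real^('p option)" where
  "eta_star M X \<delta> f \<beta>0 q0 = arg_min (\<lambda>\<eta>.
     1/4 * (LINT \<omega>|M. (\<eta> \<bullet> ((\<delta> \<omega> *\<^sub>R outer (A_vec f q0 \<beta>0 (X \<omega>))) *v \<eta>))
                / (h f q0 (X \<omega> \<bullet> \<beta>0) * (1 - h f q0 (X \<omega> \<bullet> \<beta>0))))
     - (LINT \<omega>|M. A_vec f q0 \<beta>0 (X \<omega>)) \<bullet> \<eta>) (\<lambda>_. True)"

end

theory Submission
  imports Defs
begin

text \<open>Put \<open>Z = \<delta> A / (2 \<surd>\<tau>)\<close> and \<open>R = \<delta> r \<surd>\<tau>\<close>, evaluated at \<open>X\<close>. Inverse probability weighting gives
  \<open>E[A] = E[\<delta> r A]\<close>, so completing the square turns the objective defining \<open>\<eta>\<^sup>*\<close> into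
  \<open>E (R - \<eta> \<bullet> Z)\<^sup>2 - E R\<^sup>2\<close>. Hence \<open>\<eta>\<^sup>* \<bullet> Z\<close> is an orthogonal projection of \<open>R\<close>, and by Pythagoras
  \<open>V\<^sub>b - V = E (R - \<eta>\<^sup>* \<bullet> Z)\<^sup>2\<close>, the squared distance from \<open>r\<close> to the span of \<open>e\<close>.\<close>

section \<open>Supports, square integrability and self-adjoint operators\<close>

text \<open>Every point outside the support lies in a basic open set of measure zero, and a
  countable basis has only countably many of these. This turns bounds stated on the support of
  \<open>X\<close> into almost sure bounds.\<close>

lemma AE_in_support_of:
  fixes N :: "'b::second_countable_topology measure"
  assumes sets: "sets N = sets borel"
  shows "AE x in N. x \<in> support_of N"
proof -
  obtain B :: "'b set set" where B: "countable B" "topological_basis B"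
    using ex_countable_basis by auto
  let ?B = "{U \<in> B. emeasure N U = 0}"
  have open_B: "open U" if "U \<in> B" for U
    using B(2) that by (rule topological_basis_open)
  have "\<Union>?B \<in> null_sets N"
  proof -
    have "(\<Union>U\<in>?B. U) \<in> null_sets N"
    proof (rule null_sets_UN')
      show "countable ?B"
        using B(1) by (rule countable_subset[rotated]) auto
      show "U \<in> null_sets N" if "U \<in> ?B" for U
        using that open_B[of U] by (auto simp: null_sets_def sets)
    qed
    then show ?thesis by simp
  qed
  moreover have "x \<in> \<Union>?B" if x: "x \<notin> support_of N" for x
  proof -
    obtain U where U: "open U" "x \<in> U" "emeasure N U = 0"
      using x by (auto simp: support_of_def)
    obtain W where W: "W \<in> B" "x \<in> W" "W \<subseteq> U"
      using topological_basisE[OF B(2) U(1,2)] by blast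
    have "emeasure N W \<le> emeasure N U"
      using W(3) U(1) by (intro emeasure_mono) (auto simp: sets)
    then show ?thesis using W U(3) by auto
  qed
  ultimately show ?thesis
    by (intro AE_I[of _ _ "\<Union>?B"]) (auto simp: null_sets_def)
qed

lemma integrable_mult_square:
  fixes f g :: "'a \<Rightarrow> real"
  assumes [measurable]: "f \<in> borel_measurable M" "g \<in> borel_measurable M"
    and "integrable M (\<lambda>x. (f x)\<^sup>2)" "integrable M (\<lambda>x. (g x)\<^sup>2)"
  shows "integrable M (\<lambda>x. f x * g x)"
proof (rule Bochner_Integration.integrable_bound)
  show "integrable M (\<lambda>x. (f x)\<^sup>2 + (g x)\<^sup>2)" using assms by simp
  have "\<bar>f x * g x\<bar> \<le> (f x)\<^sup>2 + (g x)\<^sup>2" for x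
  proof -
    have "2 * \<bar>f x * g x\<bar> \<le> (f x)\<^sup>2 + (g x)\<^sup>2"
      using sum_squares_bound[of "\<bar>f x\<bar>" "\<bar>g x\<bar>"] by (simp add: abs_mult mult.assoc)
    then show ?thesis by linarith
  qed
  then show "AE x in M. norm (f x * g x) \<le> norm ((f x)\<^sup>2 + (g x)\<^sup>2)" by simp
qed measurable

lemma integrable_inner_square:
  fixes Z :: "'a \<Rightarrow> 'v::euclidean_space"
  assumes [measurable]: "Z \<in> borel_measurable M"
    and "integrable M (\<lambda>x. (norm (Z x))\<^sup>2)"
  shows "integrable M (\<lambda>x. (v \<bullet> Z x)\<^sup>2)"
proof (rule Bochner_Integration.integrable_bound)
  show "integrable M (\<lambda>x. (norm v)\<^sup>2 * (norm (Z x))\<^sup>2)" using assms by simp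
  have "(v \<bullet> Z x)\<^sup>2 \<le> (norm v)\<^sup>2 * (norm (Z x))\<^sup>2" for x
    using Cauchy_Schwarz_ineq[of v "Z x"] by (simp add: power2_norm_eq_inner)
  then show "AE x in M. norm ((v \<bullet> Z x)\<^sup>2) \<le> norm ((norm v)\<^sup>2 * (norm (Z x))\<^sup>2)" by simp
qed measurable

text \<open>The range of a self-adjoint operator is the orthogonal complement of its kernel.\<close>

lemma self_adjoint_solvable:
  fixes B :: "'v::euclidean_space \<Rightarrow> 'v"
  assumes "linear B" and adj: "\<And>x y. B x \<bullet> y = x \<bullet> B y"
    and m: "\<And>z. B z = 0 \<Longrightarrow> m \<bullet> z = 0"
  obtains v where "B v = m"
proof -
  have sub: "subspace (range B)"
    using assms(1) by (intro linear_subspace_image) auto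
  obtain y z where y: "y \<in> span (range B)" and z: "\<And>w. w \<in> span (range B) \<Longrightarrow> orthogonal z w"
    and m_eq: "m = y + z"
    using orthogonal_subspace_decomp_exists[of "range B" m] by metis
  \<comment> \<open>Self-adjointness moves \<open>B\<close> onto \<open>w\<close>, and
    \<open>z\<close> is orthogonal to the range, so \<open>z\<close> lies in the kernel.\<close>
  have "B z \<bullet> w = 0" for w
    using z[OF span_base[OF rangeI[of B w]]] by (simp add: adj orthogonal_def)
  then have "B z = 0" by (metis inner_eq_zero_iff)
  then have "m \<bullet> z = 0" by (rule m)
  moreover have "y \<bullet> z = 0" using z[OF y] by (simp add: orthogonal_def inner_commute)
  ultimately have "z = 0" by (simp add: m_eq inner_add_left)
  then have "m \<in> range B" using y m_eq span_eq_iff[THEN iffD2, OF sub] by simp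
  then show thesis using that by auto
qed

section \<open>Least squares regression of \<open>R\<close> on the coordinates of
  \<open>Z\<close>\<close>

locale least_squares =
  fixes M :: "'a measure" and Z :: "'a \<Rightarrow> 'v::euclidean_space" and R :: "'a \<Rightarrow> real"
  assumes Z_measurable [measurable]: "Z \<in> borel_measurable M"
    and R_measurable [measurable]: "R \<in> borel_measurable M"
    and Z_square: "integrable M (\<lambda>x. (norm (Z x))\<^sup>2)"
    and R_square: "integrable M (\<lambda>x. (R x)\<^sup>2)"
begin

lemmas inner_square = integrable_inner_square[OF Z_measurable Z_square]

lemma integrable_inner_inner: "integrable M (\<lambda>x. (v \<bullet> Z x) * (w \<bullet> Z x))"
  by (intro integrable_mult_square inner_square) measurable

lemma integrable_R_inner: "integrable M (\<lambda>x. R x * (v \<bullet> Z x))"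
  by (intro integrable_mult_square inner_square R_square) measurable

lemma integrable_inner_scale: "integrable M (\<lambda>x. (v \<bullet> Z x) *\<^sub>R Z x)"
proof (rule Bochner_Integration.integrable_bound)
  show "integrable M (\<lambda>x. norm v * (norm (Z x))\<^sup>2)" using Z_square by simp
  have "\<bar>v \<bullet> Z x\<bar> * norm (Z x) \<le> norm v * (norm (Z x))\<^sup>2" for x
    using mult_right_mono[OF Cauchy_Schwarz_ineq2[of v "Z x"], of "norm (Z x)"]
    by (simp add: power2_eq_square mult.assoc)
  then show "AE x in M. norm ((v \<bullet> Z x) *\<^sub>R Z x) \<le> norm (norm v * (norm (Z x))\<^sup>2)" by simp
qed measurable

lemma integrable_R_scale: "integrable M (\<lambda>x. R x *\<^sub>R Z x)"
proof -
  have "integrable M (\<lambda>x. R x * norm (Z x))"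
    using R_square Z_square by (intro integrable_mult_square) simp_all
  then show ?thesis
    by (rule Bochner_Integration.integrable_bound) (auto simp: abs_mult)
qed

lemma residual_expand:
  "(LINT x|M. (R x - v \<bullet> Z x)\<^sup>2) =
    (LINT x|M. (R x)\<^sup>2) - 2 * (LINT x|M. R x * (v \<bullet> Z x)) + (LINT x|M. (v \<bullet> Z x)\<^sup>2)"
proof -
  have "(LINT x|M. (R x - v \<bullet> Z x)\<^sup>2) =
    (LINT x|M. (R x)\<^sup>2 - 2 * (R x * (v \<bullet> Z x)) + (v \<bullet> Z x)\<^sup>2)"
    by (intro Bochner_Integration.integral_cong) (auto simp: power2_diff)
  then show ?thesis
    using R_square integrable_R_inner inner_square by simp
qed

text \<open>A solution of the normal equations \<open>B v = m\<close>, with Gram operator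
  \<open>B\<close> and moment vector \<open>m\<close>, is a minimizer: the residual integral at
  \<open>w\<close> exceeds that at \<open>v\<close> by the integral of
  \<open>((w - v) \<bullet> Z x)\<^sup>2\<close>. The equations are solvable because a kernel vector
  \<open>z\<close> of \<open>B\<close> has \<open>z \<bullet> Z x = 0\<close> almost everywhere and
  is therefore orthogonal to \<open>m\<close>.\<close>

lemma minimizer_exists:
  "\<exists>v. \<forall>w. (LINT x|M. (R x - v \<bullet> Z x)\<^sup>2) \<le> (LINT x|M. (R x - w \<bullet> Z x)\<^sup>2)"
proof -
  define B where "B v = (LINT x|M. (v \<bullet> Z x) *\<^sub>R Z x)" for v
  define m where "m = (LINT x|M. R x *\<^sub>R Z x)"
  have B_inner: "B v \<bullet> w = (LINT x|M. (v \<bullet> Z x) * (w \<bullet> Z x))" for v w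
    using integral_inner_left[OF integrable_inner_scale, of v w]
    by (simp add: B_def inner_commute)
  have m_inner: "m \<bullet> w = (LINT x|M. R x * (w \<bullet> Z x))" for w
    using integral_inner_left[OF integrable_R_scale, of w]
    by (simp add: m_def inner_commute)
  have "linear B"
    by (rule linearI)
       (simp_all add: B_def inner_add_left scaleR_add_left integrable_inner_scale
          flip: scaleR_scaleR)
  moreover have "B v \<bullet> w = v \<bullet> B w" for v w
    by (simp add: B_inner inner_commute[of v "B w"] mult.commute)
  moreover have "m \<bullet> z = 0" if "B z = 0" for z
  proof -
    have "(LINT x|M. (z \<bullet> Z x)\<^sup>2) = 0"
      using B_inner[of z z] that by (simp add: power2_eq_square)
    then have "AE x in M. (z \<bullet> Z x)\<^sup>2 = 0"
      by (subst (asm) integral_nonneg_eq_0_iff_AE[OF inner_square]) auto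
    then have "(LINT x|M. R x * (z \<bullet> Z x)) = (LINT x|M. 0)"
      by (intro integral_cong_AE) auto
    then show ?thesis by (simp add: m_inner)
  qed
  ultimately obtain v where v: "B v = m" by (rule self_adjoint_solvable)
  have "(LINT x|M. (R x - v \<bullet> Z x)\<^sup>2) \<le> (LINT x|M. (R x - w \<bullet> Z x)\<^sup>2)" for w
  proof -
    have "0 \<le> (LINT x|M. ((w - v) \<bullet> Z x)\<^sup>2)" by simp
    also have "\<dots> = (LINT x|M. (w \<bullet> Z x)\<^sup>2 - 2 * ((v \<bullet> Z x) * (w \<bullet> Z x)) + (v \<bullet> Z x)\<^sup>2)"
      by (intro Bochner_Integration.integral_cong)
         (auto simp: inner_diff_left power2_diff)
    also have "\<dots> = (LINT x|M. (w \<bullet> Z x)\<^sup>2) - 2 * (B v \<bullet> w) + (LINT x|M. (v \<bullet> Z x)\<^sup>2)"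
      using inner_square integrable_inner_inner by (simp add: B_inner)
    finally have "0 \<le> (LINT x|M. (w \<bullet> Z x)\<^sup>2) - 2 * (m \<bullet> w) + (LINT x|M. (v \<bullet> Z x)\<^sup>2)"
      by (simp add: v)
    moreover have "m \<bullet> v = (LINT x|M. (v \<bullet> Z x)\<^sup>2)"
      using B_inner[of v v] by (simp add: v power2_eq_square)
    ultimately show ?thesis
      by (simp add: residual_expand flip: m_inner)
  qed
  then show ?thesis by blast
qed

text \<open>It suffices to compare \<open>v\<close> with its multiples \<open>t *\<^sub>R v\<close>.
  Stationarity at \<open>t = 1\<close> gives \<open>b = c\<close>, that is, the residual is
  orthogonal to the fit \<open>v \<bullet> Z x\<close>. The argument applies to whichever minimizer
  \<open>v\<close> is given.\<close>

lemma minimizer_pythagoras: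
  assumes min: "\<And>w. (LINT x|M. (R x - v \<bullet> Z x)\<^sup>2) \<le> (LINT x|M. (R x - w \<bullet> Z x)\<^sup>2)"
  shows "(LINT x|M. (R x)\<^sup>2) = (LINT x|M. (v \<bullet> Z x)\<^sup>2) + (LINT x|M. (R x - v \<bullet> Z x)\<^sup>2)"
proof -
  define b c where "b = (LINT x|M. R x * (v \<bullet> Z x))" and "c = (LINT x|M. (v \<bullet> Z x)\<^sup>2)"
  have ineq: "- 2 * b + c \<le> - 2 * (t * b) + t\<^sup>2 * c" for t
  proof -
    have "(LINT x|M. R x * ((t *\<^sub>R v) \<bullet> Z x)) = (LINT x|M. t * (R x * (v \<bullet> Z x)))"
      by (intro Bochner_Integration.integral_cong) (auto simp: algebra_simps)
    then have "(LINT x|M. R x * ((t *\<^sub>R v) \<bullet> Z x)) = t * b" by (simp add: b_def)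
    moreover have "(LINT x|M. ((t *\<^sub>R v) \<bullet> Z x)\<^sup>2) = t\<^sup>2 * c"
      by (simp add: power_mult_distrib c_def)
    ultimately show ?thesis
      using min[of "t *\<^sub>R v"] unfolding residual_expand
      by (simp add: b_def[symmetric] c_def[symmetric])
  qed
  have c: "0 \<le> c" by (simp add: c_def)
  have "b = c"
  proof (rule ccontr)
    assume "b \<noteq> c"
    \<comment> \<open>A perturbation of \<open>t = 1\<close> to \<open>1 + s\<close>. The
      denominator \<open>c + 1\<close> is positive even if \<open>c = 0\<close>, and the resulting
      change \<open>- (s\<^sup>2 * (c + 2))\<close> is strictly negative.\<close>
    define s where "s = (b - c) / (c + 1)"
    have s: "s * (c + 1) = b - c" using c by (simp add: s_def)
    have "s \<noteq> 0" using \<open>b \<noteq> c\<close> c by (simp add: s_def)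
    have "0 \<le> s\<^sup>2 * c - 2 * s * (b - c)"
      using ineq[of "1 + s"] by (simp add: algebra_simps power2_eq_square)
    also have "\<dots> = - (s\<^sup>2 * (c + 2))"
      by (simp add: s[symmetric] algebra_simps power2_eq_square)
    finally show False using \<open>s \<noteq> 0\<close> c by (simp add: mult_le_0_iff)
  qed
  then show ?thesis by (simp add: residual_expand b_def[symmetric] c_def[symmetric])
qed

end

section \<open>Rank-one quadratic forms, chosen minimizers and inverse probability weighting\<close>

lemma outer_quadratic_form: "v \<bullet> ((c *\<^sub>R outer a) *v v) = c * (v \<bullet> a)\<^sup>2"
proof -
  have "outer a *v v = (a \<bullet> v) *\<^sub>R a"
    by (simp add: vec_eq_iff matrix_vector_mult_def outer_def inner_vec_def
        sum_distrib_left mult.commute mult.left_commute)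
  then show ?thesis
    by (simp add: scaleR_matrix_vector_assoc[symmetric] power2_eq_square inner_commute)
qed

text \<open>\<open>arg_min\<close> is a Hilbert choice, so its value is known to minimize only once
  some minimizer has been exhibited.\<close>

lemma is_arg_min_arg_min:
  assumes "is_arg_min F P x"
  shows "is_arg_min F P (arg_min F P)"
  unfolding arg_min_def using assms by (rule someI)

text \<open>Condition on \<open>X\<close>: the factor \<open>G\<close> is measurable for the
  sigma-algebra generated by \<open>X\<close> and comes out, while \<open>mar_X\<close> replaces the
  indicator of \<open>\<delta> = 1\<close> by \<open>\<pi> (X \<omega>)\<close>, which cancels the
  weight.\<close>

lemma (in mar_model) inverse_probability_weighting:
  assumes g [measurable]: "g \<in> borel_measurable borel"
    and pos: "AE \<omega> in M. \<pi> (X \<omega>) \<noteq> 0"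
    and int: "integrable M (\<lambda>\<omega>. \<delta> \<omega> * inverse (\<pi> (X \<omega>)) * g (X \<omega>))"
  shows "(LINT \<omega>|M. \<delta> \<omega> * inverse (\<pi> (X \<omega>)) * g (X \<omega>)) = (LINT \<omega>|M. g (X \<omega>))"
proof -
  note X_rv [measurable] delta_rv [measurable] pi_measurable [measurable]
  define F where "F = vimage_algebra (space M) X borel"
  define D where "D = {\<omega> \<in> space M. \<delta> \<omega> = 1}"
  have [measurable]: "D \<in> sets M" unfolding D_def by measurable
  have sub: "subalgebra M F"
    unfolding subalgebra_def F_def using sets_image_in_sets[OF refl X_rv] by simp
  interpret finite_measure_subalgebra M F
    by unfold_locales (rule sub)
  have XF: "X \<in> borel_measurable F"
    unfolding F_def by (rule measurable_vimage_algebra1) auto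
  define G where "G = (\<lambda>\<omega>. inverse (\<pi> (X \<omega>)) * g (X \<omega>))"
  have GF: "G \<in> borel_measurable F"
    unfolding G_def by (rule measurable_compose[OF XF]) measurable
  have G_D: "\<delta> \<omega> * inverse (\<pi> (X \<omega>)) * g (X \<omega>) = G \<omega> * indicator D \<omega>"
    if "\<omega> \<in> space M" for \<omega>
    using delta_01[OF that] that by (auto simp: G_def D_def)
  have GM: "integrable M (\<lambda>\<omega>. G \<omega> * indicator D \<omega>)"
    using int by (rule Bochner_Integration.integrable_cong[THEN iffD1, rotated -1]) (auto simp: G_D)
  have G [measurable]: "G \<in> borel_measurable M"
    unfolding G_def by measurable
  have "(LINT \<omega>|M. \<delta> \<omega> * inverse (\<pi> (X \<omega>)) * g (X \<omega>)) = (LINT \<omega>|M. G \<omega> * indicator D \<omega>)"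
    by (intro Bochner_Integration.integral_cong) (auto simp: G_D)
  also have "\<dots> = (LINT \<omega>|M. G \<omega> * real_cond_exp M F (indicator D) \<omega>)"
    by (rule real_cond_exp_intg(2)[symmetric]) (use GM GF in auto)
  also have "\<dots> = (LINT \<omega>|M. g (X \<omega>))"
  proof (rule integral_cong_AE)
    show "AE \<omega> in M. G \<omega> * real_cond_exp M F (indicator D) \<omega> = g (X \<omega>)"
      using mar_X pos unfolding F_def[symmetric] D_def[symmetric]
      by eventually_elim (simp add: G_def)
  qed (use borel_measurable_cond_exp2 in measurable)
  finally show ?thesis .
qed

theorem mainTheorem3:
  fixes M :: "'a measure" and X :: "'a \<Rightarrow> real^'p" and Y \<delta> :: "'a \<Rightarrow> real"
    and \<pi> \<tau> r :: "real^'p \<Rightarrow> real" and f :: "real \<Rightarrow> real \<Rightarrow> real" and \<beta>0 :: "real^'p"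
    and \<alpha> q0 T V V\<^sub>b \<sigma>2 \<sigma>2\<^sub>b :: real and Q :: "real set"
    and A e :: "real^'p \<Rightarrow> real^('p option)" and \<eta> :: "real^('p option)"
  assumes model: "mar_model M X Y \<delta> \<pi> f \<beta>0"
    and level: "0 < \<alpha>" "\<alpha> < 1"
    and q0: "q0 = quantile (distr M borel Y) \<alpha>"
    and A1: "cond_A1 M Y Q q0"
    and A2: "cond_A2 M X \<pi>"
    and A3: "cond_A3 M X f \<beta>0 Q q0"
    and A4: "cond_A4 M X"
    and A5: "cond_A5 M X Y \<delta> f \<beta>0"
    and A: "A = A_vec f q0 \<beta>0"
    and eig_A: "\<exists>c>0. c \<le> min_eigenvalue (LINT \<omega>|M. outer (A (X \<omega>)))"
    and T: "T = (LINT \<omega>|M. f q0 (X \<omega> \<bullet> \<beta>0))"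
    and T_nonzero: "T \<noteq> 0"
    and tau: "\<tau> = (\<lambda>x. h f q0 (x \<bullet> \<beta>0) * (1 - h f q0 (x \<bullet> \<beta>0)))"
    and r: "r = (\<lambda>x. inverse (\<pi> x))"
    and e: "e = (\<lambda>x. inverse (\<tau> x) *\<^sub>R A x)"
    and eta: "\<eta> = eta_star M X \<delta> f \<beta>0 q0"
    and V: "V = 1/4 * (LINT \<omega>|M. (\<eta> \<bullet> ((\<delta> \<omega> *\<^sub>R outer (A (X \<omega>))) *v \<eta>)) / \<tau> (X \<omega>))
                + prob_space.variance M (\<lambda>\<omega>. h f q0 (X \<omega> \<bullet> \<beta>0))"
    and V_b: "V\<^sub>b = (LINT \<omega>|M. \<delta> \<omega> * \<tau> (X \<omega>) * (r (X \<omega>))\<^sup>2)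
                + prob_space.variance M (\<lambda>\<omega>. h f q0 (X \<omega> \<bullet> \<beta>0))"
    and sigma2: "\<sigma>2 = inverse (T\<^sup>2) * V"
    and sigma2_b: "\<sigma>2\<^sub>b = inverse (T\<^sup>2) * V\<^sub>b"
  shows "\<sigma>2 \<le> \<sigma>2\<^sub>b \<and> (r \<notin> hilbert_span M X \<delta> \<tau> e \<longrightarrow> \<sigma>2 < \<sigma>2\<^sub>b)"
proof -
  interpret mar_model M X Y \<delta> \<pi> f \<beta>0 by (rule model)
  note X_rv [measurable] delta_rv [measurable] pi_measurable [measurable]
  let ?S = "support_of (distr M borel X)"
  have X_supp: "AE \<omega> in M. X \<omega> \<in> ?S"
    using AE_in_support_of[of "distr M borel X"] by (intro AE_distrD[OF X_rv]) simp
  \<comment> \<open>The smoothness conditions on \<open>h\<close> hold for levels in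
    \<open>Q\<close> only, so this makes them available at \<open>q0\<close>.\<close>
  have q0_Q: "q0 \<in> Q"
    using A1 interior_subset by (auto simp: cond_A1_def)

  from A3 have h_INF: "0 < (INF x\<in>?S. ereal \<bar>h f q0 (x \<bullet> \<beta>0)\<bar>)"
    and h_SUP: "(SUP x\<in>?S. ereal \<bar>h f q0 (x \<bullet> \<beta>0)\<bar>) < 1"
    and h_diff: "h f q0 differentiable (at u)"
    and h_dot_SUP: "(SUP (q, u) \<in> Q \<times> UNIV. ereal \<bar>h_dot f q u\<bar>) < \<infinity>"
    and h_dot_Lipschitz: "\<exists>L1>0. \<forall>q1\<in>Q. \<forall>q2\<in>Q. \<forall>u1 u2.
        \<bar>h_dot f q1 u1 - h_dot f q2 u2\<bar> \<le> L1 * (\<bar>q1 - q2\<bar> + \<bar>u1 - u2\<bar>)" for u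
    using q0_Q unfolding cond_A3_def by simp_all

  \<comment> \<open>Uniform bounds for \<open>\<pi>\<close> and \<open>\<tau>\<close> on the support
    of \<open>X\<close>\<close>
  obtain c where c: "0 < c" "\<And>x. x \<in> ?S \<Longrightarrow> c \<le> \<pi> x"
  proof -
    \<comment> \<open>The infimum lives in the extended reals; a real number strictly between 0 and
      it serves as bound without showing that the infimum is finite. The constants \<open>a\<close>,
      \<open>b\<close> and \<open>D\<close> below arise in the same way.\<close>
    obtain c where "0 < ereal c" "ereal c < (INF x\<in>?S. ereal (\<pi> x))"
      using A2 ereal_dense2[of 0] unfolding cond_A2_def by blast
    then show thesis by (intro that[of c]) (auto dest!: less_INF_D)
  qed
  obtain a where a: "0 < a" "\<And>x. x \<in> ?S \<Longrightarrow> a \<le> \<bar>h f q0 (x \<bullet> \<beta>0)\<bar>"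
  proof -
    obtain a where "0 < ereal a" "ereal a < (INF x\<in>?S. ereal \<bar>h f q0 (x \<bullet> \<beta>0)\<bar>)"
      using ereal_dense2[OF h_INF] by auto
    then show thesis
      by (intro that[of a]) (auto dest!: less_INF_D)
  qed
  obtain b where b: "b < 1" "\<And>x. x \<in> ?S \<Longrightarrow> \<bar>h f q0 (x \<bullet> \<beta>0)\<bar> \<le> b"
  proof -
    obtain b where "(SUP x\<in>?S. ereal \<bar>h f q0 (x \<bullet> \<beta>0)\<bar>) < ereal b" "ereal b < 1"
      using ereal_dense2[OF h_SUP] by auto
    then show thesis
      by (intro that[of b]) (auto dest!: SUP_lessD)
  qed
  have h_nonneg: "0 \<le> h f q u" for q u
    by (auto simp: h_def set_lebesgue_integral_def f_nonneg intro!: integral_nonneg_AE)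
  \<comment> \<open>On the support \<open>a \<le> h \<le> b < 1\<close>, so both factors of
    \<open>\<tau> = h * (1 - h)\<close> stay away from zero.\<close>
  define t where "t = a * (1 - b)"
  have t: "0 < t" using a b by (simp add: t_def)
  have tau_bounds: "t \<le> \<tau> x \<and> \<tau> x \<le> 1" if "x \<in> ?S" for x
  proof -
    have "a \<le> h f q0 (x \<bullet> \<beta>0)" "h f q0 (x \<bullet> \<beta>0) \<le> b"
      using a(2)[OF that] b(2)[OF that] h_nonneg[of q0 "x \<bullet> \<beta>0"] by auto
    then show ?thesis
      using a(1) b(1) unfolding tau t_def
      by (auto intro!: mult_mono mult_le_one)
  qed

  \<comment> \<open>Measurability, and almost sure boundedness of \<open>A\<close>\<close>
  have "isCont (h f q0) u" for u
    using h_diff by (rule differentiable_imp_continuous_within)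
  then have [measurable]: "h f q0 \<in> borel_measurable borel"
    by (intro borel_measurable_continuous_onI continuous_at_imp_continuous_on) auto
  have tau_meas [measurable]: "\<tau> \<in> borel_measurable borel"
    unfolding tau by measurable
  have r_meas [measurable]: "r \<in> borel_measurable borel"
    unfolding r by measurable

  \<comment> \<open>With both levels equal to \<open>q0\<close> the term in \<open>q\<close> drops
    out. The resulting continuity of \<open>h_dot f q0\<close> makes \<open>A\<close> continuous and
    hence Borel.\<close>
  obtain L where L: "0 < L" "\<And>u v. \<bar>h_dot f q0 u - h_dot f q0 v\<bar> \<le> L * \<bar>u - v\<bar>"
  proof -
    obtain L where "0 < L" and L: "\<forall>q1\<in>Q. \<forall>q2\<in>Q. \<forall>u1 u2.
        \<bar>h_dot f q1 u1 - h_dot f q2 u2\<bar> \<le> L * (\<bar>q1 - q2\<bar> + \<bar>u1 - u2\<bar>)"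
      using h_dot_Lipschitz by blast
    then show thesis
      using L[rule_format, OF q0_Q q0_Q] by (intro that[of L]) auto
  qed
  have "continuous_on UNIV (h_dot f q0)"
    by (rule lipschitz_on_continuous_on[of L], rule lipschitz_onI)
       (use L in \<open>auto simp: dist_real_def\<close>)
  then have h_dot_cont: "continuous_on S (\<lambda>x. h_dot f q0 (x \<bullet> \<beta>0))" for S :: "(real^'p) set"
    by (rule continuous_on_compose2) (auto intro!: continuous_intros)
  have "continuous_on UNIV A"
    unfolding A A_vec_def
  proof (rule continuous_on_vec_lambda)
    show "continuous_on UNIV
      (\<lambda>x. case i of Some j \<Rightarrow> h_dot f q0 (x \<bullet> \<beta>0) * x $ j | None \<Rightarrow> 1)" for i :: "'p option"
      by (cases i) (auto intro!: continuous_intros h_dot_cont)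
  qed
  then have A_meas [measurable]: "A \<in> borel_measurable borel"
    by (rule borel_measurable_continuous_onI)

  obtain D where D: "\<And>u. \<bar>h_dot f q0 u\<bar> \<le> D"
  proof -
    obtain D where "(SUP (q, u) \<in> Q \<times> UNIV. ereal \<bar>h_dot f q u\<bar>) < ereal D"
      using ereal_dense2[OF h_dot_SUP] by auto
    then have "\<bar>h_dot f q0 u\<bar> < D" for u
      using SUP_lessD[of "\<lambda>(q, u). ereal \<bar>h_dot f q u\<bar>" "Q \<times> UNIV" "ereal D" "(q0, u)"] q0_Q by fastforce
    then show thesis using that less_imp_le by blast
  qed
  obtain C where C: "AE \<omega> in M. norm (A (X \<omega>)) \<le> C"
  proof -
    obtain K where K: "0 < K" "AE \<omega> in M. \<forall>j. \<bar>X \<omega> $ j\<bar> \<le> K"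
      using A4 unfolding cond_A4_def by blast
    have D0: "0 \<le> D" using D[of 0] by linarith
    have bound: "norm (A x) \<le> (\<Sum>i\<in>(UNIV :: 'p option set). D * K + 1)" if "\<forall>j. \<bar>x $ j\<bar> \<le> K" for x
    proof -
      \<comment> \<open>The summand \<open>D * K\<close> bounds the coordinates carrying a
        covariate, the summand 1 the constant last one.\<close>
      have "\<bar>A x $ i\<bar> \<le> D * K + 1" for i
      proof (cases i)
        case (Some j)
        have "\<bar>h_dot f q0 (x \<bullet> \<beta>0)\<bar> * \<bar>x $ j\<bar> \<le> D * K"
          using D that D0 by (intro mult_mono) auto
        then show ?thesis by (simp add: A A_vec_def Some abs_mult)
      qed (use D0 K in \<open>simp add: A A_vec_def\<close>)
      then show ?thesis
        by (intro order_trans[OF norm_le_l1_cart] sum_mono)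
    qed
    have "AE \<omega> in M. norm (A (X \<omega>)) \<le> (\<Sum>i\<in>(UNIV :: 'p option set). D * K + 1)"
      using K(2) by eventually_elim (rule bound)
    then show thesis by (rule that)
  qed
  have A_int: "integrable M (\<lambda>\<omega>. A (X \<omega>))"
    using C by (rule integrable_const_bound) measurable

  \<comment> \<open>The regression of \<open>R\<close> on \<open>Z\<close>\<close>
  \<comment> \<open>The 2 absorbs the factor 1/4 of the objective, and the roots of
    \<open>\<tau>\<close> cancel in the product of \<open>R\<close> and \<open>Z\<close>. The
    identities below use that \<open>\<delta>\<close> equals its square and that
    \<open>\<tau>\<close> is positive on the support, hence their almost sure form.\<close>
  define Z where "Z = (\<lambda>\<omega>. (\<delta> \<omega> / (2 * sqrt (\<tau> (X \<omega>)))) *\<^sub>R A (X \<omega>))"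
  define R where "R = (\<lambda>\<omega>. \<delta> \<omega> * sqrt (\<tau> (X \<omega>)) * r (X \<omega>))"
  have delta_AE: "AE \<omega> in M. \<delta> \<omega> \<in> {0, 1}"
    using delta_01 by auto
  have r_bound: "\<bar>r x\<bar> \<le> inverse c" if "x \<in> ?S" for x
    using c(1) c(2)[OF that] by (simp add: r le_imp_inverse_le)
  have R_sq: "AE \<omega> in M. (R \<omega>)\<^sup>2 = \<delta> \<omega> * \<tau> (X \<omega>) * (r (X \<omega>))\<^sup>2"
    using X_supp delta_AE
  proof eventually_elim
    case (elim \<omega>)
    then show ?case using tau_bounds[of "X \<omega>"] t by (auto simp: R_def power_mult_distrib)
  qed
  have inner_sq: "AE \<omega> in M. (v \<bullet> Z \<omega>)\<^sup>2 = 1/4 * ((v \<bullet> ((\<delta> \<omega> *\<^sub>R outer (A (X \<omega>))) *v v)) / \<tau> (X \<omega>))"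
    for v
    using X_supp delta_AE
  proof eventually_elim
    case (elim \<omega>)
    then show ?case using tau_bounds[of "X \<omega>"] t
      by (auto simp: Z_def power_mult_distrib power_divide outer_quadratic_form)
  qed
  have R_inner: "AE \<omega> in M. R \<omega> * (v \<bullet> Z \<omega>) = 1/2 * (\<delta> \<omega> * inverse (\<pi> (X \<omega>)) * (v \<bullet> A (X \<omega>)))" for v
    using X_supp delta_AE
  proof eventually_elim
    case (elim \<omega>)
    then show ?case using tau_bounds[of "X \<omega>"] t by (auto simp: Z_def R_def r)
  qed
  interpret LS: least_squares M Z R
  proof
    show "Z \<in> borel_measurable M" "R \<in> borel_measurable M"
      unfolding Z_def R_def by measurable
    then have [measurable]: "Z \<in> borel_measurable M" "R \<in> borel_measurable M" .
    show "integrable M (\<lambda>x. (norm (Z x))\<^sup>2)"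
    proof (rule integrable_const_bound)
      show "AE \<omega> in M. norm ((norm (Z \<omega>))\<^sup>2) \<le> C\<^sup>2 / (4 * t)"
        using X_supp delta_AE C
      proof eventually_elim
        case (elim \<omega>)
        have "(norm (A (X \<omega>)))\<^sup>2 / (4 * \<tau> (X \<omega>)) \<le> C\<^sup>2 / (4 * t)"
          using tau_bounds[OF elim(1)] t elim(3) by (intro frac_le power_mono) auto
        then show ?case using tau_bounds[OF elim(1)] t elim(2)
          by (auto simp: Z_def power_mult_distrib power_divide)
      qed
    qed measurable
    show "integrable M (\<lambda>x. (R x)\<^sup>2)"
    proof (rule integrable_const_bound)
      show "AE \<omega> in M. norm ((R \<omega>)\<^sup>2) \<le> 1 * (inverse c)\<^sup>2"
        using X_supp delta_AE R_sq
      proof eventually_elim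
        case (elim \<omega>)
        have "\<tau> (X \<omega>) * \<bar>r (X \<omega>)\<bar>\<^sup>2 \<le> 1 * (inverse c)\<^sup>2"
          using tau_bounds[OF elim(1)] t r_bound[OF elim(1)]
          by (intro mult_mono power_mono) auto
        then have "(R \<omega>)\<^sup>2 \<le> (inverse c)\<^sup>2"
          using elim(2) unfolding elim(3) by auto
        then show ?case by simp
      qed
    qed measurable
  qed

  \<comment> \<open>The objective and the variances as least squares integrals\<close>
  have int_R_inner: "(LINT \<omega>|M. R \<omega> * (v \<bullet> Z \<omega>)) = 1/2 * ((LINT \<omega>|M. A (X \<omega>)) \<bullet> v)" for v
  proof -
    have eq: "AE \<omega> in M. \<delta> \<omega> * inverse (\<pi> (X \<omega>)) * (v \<bullet> A (X \<omega>)) = 2 * (R \<omega> * (v \<bullet> Z \<omega>))"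
      using R_inner[of v] by eventually_elim simp
    have int: "integrable M (\<lambda>\<omega>. \<delta> \<omega> * inverse (\<pi> (X \<omega>)) * (v \<bullet> A (X \<omega>)))"
      by (subst integrable_cong_AE[OF _ _ eq]) (auto intro!: LS.integrable_R_inner)
    have pos: "AE \<omega> in M. \<pi> (X \<omega>) \<noteq> 0"
      using X_supp
    proof eventually_elim
      case (elim \<omega>)
      then show ?case using c(1) c(2)[of "X \<omega>"] by auto
    qed
    have "(LINT \<omega>|M. R \<omega> * (v \<bullet> Z \<omega>)) =
        (LINT \<omega>|M. 1/2 * (\<delta> \<omega> * inverse (\<pi> (X \<omega>)) * (v \<bullet> A (X \<omega>))))"
      using R_inner[of v] by (intro integral_cong_AE) auto
    also have "\<dots> = 1/2 * (LINT \<omega>|M. \<delta> \<omega> * inverse (\<pi> (X \<omega>)) * (v \<bullet> A (X \<omega>)))"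
      by (rule integral_mult_right_zero)
    also have "\<dots> = 1/2 * (LINT \<omega>|M. v \<bullet> A (X \<omega>))"
      using inverse_probability_weighting[of "\<lambda>x. v \<bullet> A x", OF _ pos int] by simp
    also have "(LINT \<omega>|M. v \<bullet> A (X \<omega>)) = (LINT \<omega>|M. A (X \<omega>)) \<bullet> v"
      using A_int by (simp add: inner_commute)
    finally show ?thesis .
  qed
  have int_inner_sq: "1/4 * (LINT \<omega>|M. (v \<bullet> ((\<delta> \<omega> *\<^sub>R outer (A (X \<omega>))) *v v)) / \<tau> (X \<omega>)) =
      (LINT \<omega>|M. (v \<bullet> Z \<omega>)\<^sup>2)" for v
  proof -
    have "(LINT \<omega>|M. (v \<bullet> Z \<omega>)\<^sup>2) =
        (LINT \<omega>|M. 1/4 * ((v \<bullet> ((\<delta> \<omega> *\<^sub>R outer (A (X \<omega>))) *v v)) / \<tau> (X \<omega>)))"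
      using inner_sq[of v]
      by (intro integral_cong_AE) (auto simp: outer_quadratic_form)
    then show ?thesis by (simp only: integral_mult_right_zero)
  qed
  have int_R_sq: "(LINT \<omega>|M. \<delta> \<omega> * \<tau> (X \<omega>) * (r (X \<omega>))\<^sup>2) = (LINT \<omega>|M. (R \<omega>)\<^sup>2)"
    using R_sq by (intro integral_cong_AE) auto

  define J where "J = (\<lambda>v. 1/4 * (LINT \<omega>|M. (v \<bullet> ((\<delta> \<omega> *\<^sub>R outer (A (X \<omega>))) *v v)) / \<tau> (X \<omega>))
     - (LINT \<omega>|M. A (X \<omega>)) \<bullet> v)"
  \<comment> \<open>The 1/2 in \<open>int_R_inner\<close> cancels the 2 of the cross term. The
    subtracted integral does not depend on \<open>v\<close>, so \<open>J\<close> and the residual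
    integral have the same minimizers.\<close>
  have J: "J v = (LINT \<omega>|M. (R \<omega> - v \<bullet> Z \<omega>)\<^sup>2) - (LINT \<omega>|M. (R \<omega>)\<^sup>2)" for v
    by (simp only: J_def int_inner_sq LS.residual_expand int_R_inner)
  have "\<eta> = arg_min J (\<lambda>_. True)"
    by (simp add: eta eta_star_def J_def A tau)
  moreover obtain v where "is_arg_min J (\<lambda>_. True) v"
    using LS.minimizer_exists by (auto simp: is_arg_min_def J not_less)
  ultimately have "is_arg_min J (\<lambda>_. True) \<eta>"
    using is_arg_min_arg_min by metis
  then have "(LINT \<omega>|M. (R \<omega> - \<eta> \<bullet> Z \<omega>)\<^sup>2) \<le> (LINT \<omega>|M. (R \<omega> - w \<bullet> Z \<omega>)\<^sup>2)" for w
    by (auto simp: is_arg_min_def J not_less)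
  then have pyth: "V\<^sub>b = V + (LINT \<omega>|M. (R \<omega> - \<eta> \<bullet> Z \<omega>)\<^sup>2)"
    unfolding V V_b int_inner_sq int_R_sq by (simp add: LS.minimizer_pythagoras)
  have T_pos: "0 < inverse (T\<^sup>2)"
    using T_nonzero by simp

  \<comment> \<open>Strictness, by contraposition: a vanishing residual puts \<open>r\<close> in the
    span\<close>
  have "r \<in> hilbert_span M X \<delta> \<tau> e" if zero: "(LINT \<omega>|M. (R \<omega> - \<eta> \<bullet> Z \<omega>)\<^sup>2) = 0"
  proof -
    have "integrable M (\<lambda>\<omega>. \<delta> \<omega> * \<tau> (X \<omega>) * (r (X \<omega>))\<^sup>2)"
      using R_sq LS.R_square by (subst integrable_cong_AE[of _ _ "\<lambda>\<omega>. (R \<omega>)\<^sup>2"]) auto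
    then have carrier: "r \<in> hilbert_carrier M X \<delta> \<tau>"
      by (simp add: hilbert_carrier_def)
    \<comment> \<open>Since \<open>A = \<tau> e\<close> on the support, \<open>Z\<close> is
      \<open>\<delta> * sqrt \<tau> / 2\<close> times \<open>e\<close>; the coefficients of the fit
      in terms of \<open>e\<close> are therefore halves of those of \<open>\<eta>\<close>.\<close>
    define d where "d = (\<lambda>x. r x - (\<Sum>i\<in>UNIV. (\<eta> $ i / 2) * e x $ i))"
    have d: "d x = r x - (\<eta> \<bullet> A x) / (2 * \<tau> x)" for x
      by (simp add: d_def e inner_vec_def sum_divide_distrib field_simps)
    have "AE \<omega> in M. \<delta> \<omega> * \<tau> (X \<omega>) * d (X \<omega>) * d (X \<omega>) = (R \<omega> - \<eta> \<bullet> Z \<omega>)\<^sup>2"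
      using X_supp delta_AE
    proof eventually_elim
      case (elim \<omega>)
      have pos: "0 < \<tau> (X \<omega>)" using tau_bounds[OF elim(1)] t by linarith
      define s where "s = sqrt (\<tau> (X \<omega>))"
      have s: "0 < s" "\<tau> (X \<omega>) = s\<^sup>2" using pos by (auto simp: s_def)
      have "R \<omega> - \<eta> \<bullet> Z \<omega> = \<delta> \<omega> * (s * d (X \<omega>))"
        using s(1) by (simp add: R_def Z_def d s_def[symmetric] s(2) field_simps power2_eq_square)
      then show ?case using elim(2) by (auto simp: s(2) power2_eq_square)
    qed
    then have "hilbert_inner M X \<delta> \<tau> d d = 0"
      unfolding hilbert_inner_def zero[symmetric]
      by (intro integral_cong_AE) (auto simp: d)
    then show ?thesis
      using carrier by (auto simp: hilbert_span_def d_def Let_def intro!: exI[of _ "\<lambda>i. \<eta> $ i / 2"])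
  qed
  moreover have "0 \<le> (LINT \<omega>|M. (R \<omega> - \<eta> \<bullet> Z \<omega>)\<^sup>2)" by simp
  ultimately show ?thesis
    using T_pos by (auto simp: sigma2 sigma2_b pyth less_le)
qed

end
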